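(* As $d\to\infty$ one has $\operatorname{rc}(\Delta_d)\in O\left(\frac{d}{\sqrt{\log d}}\right)$; that is, there is a constant $C>0$ such that $\operatorname{rc}(\Delta_d)\le C\,\frac{d}{\sqrt{\log d}}$ for all integers $d\ge 2$.
   Context: $\Delta_d=\{\mathbf{0},e_1,\dots,e_d\}\subset\mathbb{Z}^d$, where $e_1,\dots,e_d$ are the standard unit vectors of $\mathbb{R}^d$. A polyhedron is an intersection of finitely many closed half-spaces with arbitrary real (possibly irrational) coefficients; it may be unbounded. For $X\subseteq\mathbb{Z}^d$, a relaxation of $X$ is a polyhedron $Q\subseteq\mathbb{R}^d$ with $Q\cap\mathbb{Z}^d=X$. The relaxation complexity $\operatorname{rc}(X)$ is the minimal number of facets of a relaxation of $X$ ($\infty$ if no relaxation exists). *)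

theory Defs
  imports "HOL-Analysis.Analysis" "HOL-Analysis.Finite_Function_Topology" "HOL-Library.Extended_Real"
begin

text \<open>
  Since the dimension d is a bound variable of the statement, \<open>\<real>\<^sup>d\<close> is not a type here but the subspace
  \<^term>\<open>{x :: nat \<Rightarrow>\<^sub>0 real. Poly_Mapping.keys x \<subseteq> {..<d}}\<close> of the real vector space of finitely
  supported sequences; coordinates are indexed from 0. This makes \<^const>\<open>face_of\<close> and
  \<^const>\<open>dim\<close> available, but not the notions restricted to the class
  \<^class>\<open>euclidean_space\<close> (inner product, \<^const>\<open>polyhedron\<close>, \<^const>\<open>aff_dim\<close>, \<^const>\<open>facet_of\<close>),
  which are restated below.
\<close>

type_synonym rvec = "nat \<Rightarrow>\<^sub>0 real"

definition Rspace :: "nat \<Rightarrow> rvec set" where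
  "Rspace d = {x. Poly_Mapping.keys x \<subseteq> {..<d}}"

definition Zlattice :: "nat \<Rightarrow> rvec set" where
  "Zlattice d = {x \<in> Rspace d. \<forall>i. Poly_Mapping.lookup x i \<in> \<int>}"

definition dotp :: "nat \<Rightarrow> rvec \<Rightarrow> rvec \<Rightarrow> real" where
  "dotp d a x = (\<Sum>i<d. Poly_Mapping.lookup a i * Poly_Mapping.lookup x i)"

definition halfspace_in :: "nat \<Rightarrow> rvec set \<Rightarrow> bool" where
  "halfspace_in d H \<longleftrightarrow>
     (\<exists>a\<in>Rspace d. \<exists>b. a \<noteq> 0 \<and> H = {x \<in> Rspace d. dotp d a x \<le> b})"

text \<open>The intersection with \<^term>\<open>Rspace d\<close> only matters for the empty family of half-spaces.\<close>

definition polyhedron_in :: "nat \<Rightarrow> rvec set \<Rightarrow> bool" where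
  "polyhedron_in d Q \<longleftrightarrow>
     (\<exists>\<H>. finite \<H> \<and> (\<forall>H\<in>\<H>. halfspace_in d H) \<and> Q = Rspace d \<inter> \<Inter>\<H>)"

text \<open>
  The affine dimension of a nonempty set, as the dimension of the linear space parallel to its
  affine hull. (The value for the empty set is 0, but facets are nonempty by definition.)
\<close>

definition affdim :: "'a::real_vector set \<Rightarrow> nat" where
  "affdim S = dim {x - y |x y. x \<in> S \<and> y \<in> S}"

definition facets :: "'a::real_vector set \<Rightarrow> 'a set set" where
  "facets Q = {F. F face_of Q \<and> F \<noteq> {} \<and> affdim F + 1 = affdim Q}"

definition relaxation :: "nat \<Rightarrow> rvec set \<Rightarrow> rvec set \<Rightarrow> bool" where
  "relaxation d X Q \<longleftrightarrow> polyhedron_in d Q \<and> Q \<inter> Zlattice d = X"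

text \<open>
  A polyhedron has finitely many facets, so \<^const>\<open>card\<close> counts them correctly;
  the infimum of the empty set in \<^typ>\<open>enat\<close> is \<open>\<infinity>\<close>.
\<close>

definition rc :: "nat \<Rightarrow> rvec set \<Rightarrow> enat" where
  "rc d X = Inf {enat (card (facets Q)) |Q. relaxation d X Q}"

definition Delta :: "nat \<Rightarrow> rvec set" where
  "Delta d = insert 0 ((\<lambda>i. Poly_Mapping.single i 1) ` {..<d})"

end

theory Submission
  imports Defs "HOL-Computational_Algebra.Polynomial"
begin

text \<open>
  Take \<open>n\<close> with \<open>d \<le> n\<^sup>3 \<le> 8 d\<close> and view \<open>\<real>\<^sup>d\<close> as (part of) the space of
  arrays \<open>x(a,b,c)\<close> with \<open>a, b, c < n\<close>. Let \<open>w\<close> be positive reals that are linearly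
  independent over the integers, and impose on \<open>x\<close> the \<open>3 n\<^sup>2 + 1\<close> inequalities
  \<open>\<Sum>\<^sub>b w\<^sub>b x(a,b,c) \<ge> 0\<close>, \<open>\<Sum>\<^sub>a w\<^sub>a x(a,b,c) \<ge> 0\<close>, \<open>\<Sum>\<^sub>c x(a,b,c) \<ge> 0\<close> and
  \<open>\<Sum> x(a,b,c) \<le> 1\<close>. For integral \<open>x\<close> the numbers \<open>y(a,b) = \<Sum>\<^sub>c x(a,b,c)\<close> are nonnegative integers
  of sum at most 1, so they vanish outside a single position \<open>(a\<^sub>0,b\<^sub>0)\<close>. If \<open>a \<noteq> a\<^sub>0\<close>, then the
  nonnegative sums \<open>\<Sum>\<^sub>b w\<^sub>b x(a,b,c)\<close> add up over \<open>c\<close> to \<open>\<Sum>\<^sub>b w\<^sub>b y(a,b) = 0\<close>, hence each is 0,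
  and independence of \<open>w\<close> gives \<open>x(a,b,c) = 0\<close>; the case \<open>b \<noteq> b\<^sub>0\<close> is symmetric. What remains is
  the line through \<open>(a\<^sub>0,b\<^sub>0)\<close>, on which \<open>x \<ge> 0\<close>, so \<open>x\<close> is 0 or a unit vector.
  The number of inequalities is of order \<open>d\<^bsup>2/3\<^esup>\<close>, which is well below \<open>d / \<surd>(ln d)\<close>.
\<close>

section \<open>Facets of polyhedra in a real vector space\<close>

text \<open>Otherwise every constraint that is not an equality on all of \<open>Q\<close> is strict
  at some point of \<open>F\<close>. Averaging such points yields one point of \<open>F\<close>
  where all of them are strict, a relative interior point of \<open>Q\<close>, and a face containing
  such a point is all of \<open>Q\<close>.\<close>

lemma proper_face_tight_constraint:
  fixes f :: "'i \<Rightarrow> 'a::real_vector \<Rightarrow> real"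
  assumes lin: "\<And>i. i \<in> I \<Longrightarrow> linear (f i)" and fin: "finite I" and aff: "affine V"
    and Q: "Q = {x \<in> V. \<forall>i\<in>I. f i x \<le> b i}"
    and face: "F face_of Q" and ne: "F \<noteq> {}" and proper: "F \<noteq> Q"
  obtains i where "i \<in> I" "F \<subseteq> {x \<in> Q. f i x = b i}" "{x \<in> Q. f i x = b i} \<noteq> Q"
proof (rule ccontr)
  assume "\<not> thesis"
  with that have no: "\<not> (F \<subseteq> {x \<in> Q. f i x = b i} \<and> {x \<in> Q. f i x = b i} \<noteq> Q)"
    if "i \<in> I" for i
    using \<open>i \<in> I\<close> by blast
  have FQ: "F \<subseteq> Q" and conv: "convex F"
    using face by (auto simp: face_of_def)
  define J where "J = {i \<in> I. \<exists>q\<in>Q. f i q < b i}"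
  have finJ: "finite J"
    using fin by (simp add: J_def)
  have strict: "\<exists>x\<in>F. f i x < b i" if "i \<in> J" for i
  proof -
    obtain q where "i \<in> I" "q \<in> Q" "f i q < b i"
      using \<open>i \<in> J\<close> by (auto simp: J_def)
    then have "q \<in> Q - {x \<in> Q. f i x = b i}"
      by simp
    with no[OF \<open>i \<in> I\<close>] obtain x where "x \<in> F" "x \<notin> {x \<in> Q. f i x = b i}"
      by blast
    moreover from this have "f i x \<le> b i"
      using FQ \<open>i \<in> I\<close> by (auto simp: Q)
    ultimately show ?thesis
      using FQ by force
  qed
  have "\<exists>z\<in>F. \<forall>i\<in>K. f i z < b i" if "K \<subseteq> J" for K
    using finite_subset[OF that finJ] that
  proof (induction K rule: finite_induct)
    case empty
    then show ?case using ne by blast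
  next
    case (insert k K)
    then obtain z where z: "z \<in> F" "\<forall>i\<in>K. f i z < b i" by auto
    obtain x where x: "x \<in> F" "f k x < b k"
      using strict insert.prems by auto
    define m where "m = (1/2) *\<^sub>R z + (1/2) *\<^sub>R x"
    have "m \<in> F"
      unfolding m_def by (rule convexD[OF conv z(1) x(1)]) auto
    moreover have "f i m < b i" if "i \<in> insert k K" for i
    proof -
      have i: "i \<in> I" using that insert.prems by (auto simp: J_def)
      have "f i m = (f i z + f i x) / 2"
        using lin[OF i] by (simp add: m_def linear_add linear_scale)
      moreover have "f i z \<le> b i" "f i x \<le> b i"
        using z(1) x(1) FQ i by (auto simp: Q)
      moreover have "f i z < b i \<or> f i x < b i"
        using that z(2) x(2) by auto
      ultimately show ?thesis by auto
    qed
    ultimately show ?case by blast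
  qed
  then obtain z where z: "z \<in> F" and zJ: "\<And>i. i \<in> J \<Longrightarrow> f i z < b i"
    by blast
  have "q \<in> F" if q: "q \<in> Q" for q
  proof (cases "q = z")
    case False
    have "\<forall>\<^sub>F e in at_right 0. f i z + e * (f i z - f i q) < b i" if "i \<in> J" for i
    proof -
      have "((\<lambda>e. f i z + e * (f i z - f i q)) \<longlongrightarrow> f i z + 0 * (f i z - f i q)) (at_right 0)"
        by (intro tendsto_intros)
      then show ?thesis
        using order_tendstoD(2) zJ[OF that] by force
    qed
    then have "\<forall>\<^sub>F e in at_right 0. \<forall>i\<in>J. f i z + e * (f i z - f i q) < b i"
      by (simp add: eventually_ball_finite finJ)
    moreover have "\<forall>\<^sub>F e in at_right (0::real). e > 0"
      by (simp add: eventually_at_right_less)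
    ultimately have "\<forall>\<^sub>F e in at_right 0. e > 0 \<and> (\<forall>i\<in>J. f i z + e * (f i z - f i q) < b i)"
      by eventually_elim auto
    then obtain e where e: "e > 0" and eJ: "\<forall>i\<in>J. f i z + e * (f i z - f i q) < b i"
      using eventually_happens[of _ "at_right (0::real)"] by auto
    \<comment> \<open>\<open>y\<close> lies slightly beyond \<open>z\<close> on the ray from
      \<open>q\<close>. The slack of \<open>z\<close> in the constraints of \<open>J\<close> absorbs
      the step \<open>e\<close>; the other constraints are equalities on \<open>Q\<close> and
      persist along the line. So \<open>z\<close> is between \<open>q\<close> and \<open>y\<close>,
      and the face property pulls \<open>q\<close> into \<open>F\<close>.\<close>
    define y where "y = (1 + e) *\<^sub>R z + (- e) *\<^sub>R q"
    have "y \<in> Q"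
    proof -
      have "z \<in> V" "q \<in> V" using z q FQ by (auto simp: Q)
      then have "y \<in> V"
        unfolding y_def by (intro mem_affine[OF aff]) simp_all
      moreover have "f i y \<le> b i" if i: "i \<in> I" for i
      proof -
        have fy: "f i y = f i z + e * (f i z - f i q)"
          using lin[OF i] by (simp add: y_def linear_add linear_scale algebra_simps linear_diff)
        show ?thesis
        proof (cases "i \<in> J")
          case True
          then show ?thesis using eJ fy by force
        next
          case False
          then have "f i z = b i" "f i q = b i"
            using i z q FQ by (force simp: J_def Q)+
          then show ?thesis using fy by simp
        qed
      qed
      ultimately show ?thesis by (simp add: Q)
    qed
    moreover have "z \<in> open_segment q y"
      unfolding in_segment
    proof (intro conjI exI[of _ "1 / (1 + e)"])
      have comb: "z = (1 - 1 / (1 + e)) *\<^sub>R q + (1 / (1 + e)) *\<^sub>R y"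
      proof -
        have "(1 / (1 + e)) *\<^sub>R y = z - (e / (1 + e)) *\<^sub>R q"
          using e by (simp add: y_def scaleR_add_right scaleR_diff_right)
        moreover have "1 - 1 / (1 + e) = e / (1 + e)"
          using e by (simp add: field_simps)
        ultimately show ?thesis by simp
      qed
      then show "z = (1 - 1 / (1 + e)) *\<^sub>R q + (1 / (1 + e)) *\<^sub>R y" .
      show "q \<noteq> y"
      proof
        assume "q = y"
        with comb have "z = (1 - 1 / (1 + e) + 1 / (1 + e)) *\<^sub>R q"
          by (metis scaleR_add_left)
        with False show False by simp
      qed
    qed (use e in auto)
    ultimately show ?thesis
      using face_ofD[OF face] z q by blast
  qed (use z in simp)
  with FQ proper show False by blast
qed

text \<open>A basis of \<open>D\<close> stays independent after adding \<open>v\<close> and extends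
  to a basis of \<open>E\<close>. The finite spanning set keeps that basis finite; an infinite one
  would have \<open>card\<close> 0.\<close>

lemma dim_less_if_subset_and_notin_span:
  fixes D E :: "'a::real_vector set"
  assumes "D \<subseteq> E" "v \<in> E" "v \<notin> span D" and fin: "finite T" and E: "E \<subseteq> span T"
  shows "dim D < dim E"
proof -
  obtain B where B: "B \<subseteq> D" "independent B" "D \<subseteq> span B" "card B = dim D"
    using basis_exists by blast
  have "v \<notin> span B"
    using assms(3) B(1) span_mono by blast
  then have "independent (insert v B)"
    using B(2) by (rule independent_insertI)
  moreover have "insert v B \<subseteq> E" using assms B by auto
  ultimately obtain B' where B': "insert v B \<subseteq> B'" "B' \<subseteq> E" "independent B'" "E \<subseteq> span B'"
    using maximal_independent_subset_extend by metis
  have "finite B'"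
    using independent_span_bound[OF fin B'(3)] B'(2) E by blast
  moreover have "B \<subset> B'"
    using B'(1) \<open>v \<notin> span B\<close> span_base by blast
  ultimately have "card B < card B'"
    by (rule psubset_card_mono)
  then show ?thesis
    using B(4) basis_card_eq_dim[OF B'(2,4,3)] by simp
qed

lemma dim_subset_finite_span:
  fixes D E :: "'a::real_vector set"
  assumes "D \<subseteq> E" "finite T" "E \<subseteq> span T"
  shows "dim D \<le> dim E"
proof (cases "E \<subseteq> span D")
  case True
  then have "span D = span E"
    using assms(1) by (metis span_eq span_superset subset_trans)
  then show ?thesis by (metis order_refl span_eq_dim)
next
  case False
  then show ?thesis
    using dim_less_if_subset_and_notin_span[OF assms(1) _ _ assms(2,3)] by force
qed

lemma differences_subset_span:
  assumes "Q \<subseteq> span T"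
  shows "{x - y |x y. x \<in> Q \<and> y \<in> Q} \<subseteq> span T"
  using assms by (auto intro: span_diff)

lemma affdim_mono:
  assumes "F \<subseteq> Q" "finite T" "Q \<subseteq> span T"
  shows "affdim F \<le> affdim Q"
  unfolding affdim_def
  by (rule dim_subset_finite_span[OF _ assms(2) differences_subset_span[OF assms(3)]])
     (use assms(1) in blast)

text \<open>\<open>f\<close> vanishes on all differences of tight points, hence on their span, but
  not on \<open>q - p\<close> with \<open>p\<close> tight and \<open>q\<close> not.\<close>

lemma affdim_tight_less:
  fixes f :: "'a::real_vector \<Rightarrow> real"
  assumes lin: "linear f" and fin: "finite T" and Q: "Q \<subseteq> span T"
    and ne: "{x \<in> Q. f x = b} \<noteq> {}" and proper: "{x \<in> Q. f x = b} \<noteq> Q"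
  shows "affdim {x \<in> Q. f x = b} < affdim Q"
proof -
  let ?G = "{x \<in> Q. f x = b}"
  let ?D = "{x - y |x y. x \<in> ?G \<and> y \<in> ?G}"
  obtain p q where p: "p \<in> Q" "f p = b" and q: "q \<in> Q" "f q \<noteq> b"
    using ne proper by blast
  have "span ?D \<subseteq> {x. f x = 0}"
    by (rule span_minimal) (auto simp: linear_diff[OF lin] linear_subspace_kernel[OF lin])
  then have "q - p \<notin> span ?D"
    using p q by (auto simp: linear_diff[OF lin])
  then show ?thesis
    unfolding affdim_def
    by (intro dim_less_if_subset_and_notin_span[OF _ _ _ fin differences_subset_span[OF Q]])
       (use p q in blast)+
qed

text \<open>\<open>F\<close> lies in a tight set \<open>G\<close> whose dimension is already below
  that of \<open>Q\<close>. Were \<open>F\<close> smaller than \<open>G\<close>, the same argument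
  inside \<open>G\<close> would cost a second dimension, which a facet cannot afford.\<close>

lemma facet_eq_tight_set:
  fixes f :: "'i \<Rightarrow> 'a::real_vector \<Rightarrow> real"
  assumes lin: "\<And>i. i \<in> I \<Longrightarrow> linear (f i)" and finI: "finite I" and aff: "affine V"
    and Q: "Q = {x \<in> V. \<forall>i\<in>I. f i x \<le> b i}"
    and finT: "finite T" and span: "Q \<subseteq> span T"
    and facet: "F \<in> facets Q"
  obtains i where "i \<in> I" "F = {x \<in> Q. f i x = b i}"
proof -
  have face: "F face_of Q" and ne: "F \<noteq> {}" and dimF: "affdim F + 1 = affdim Q"
    using facet by (auto simp: facets_def)
  then have "F \<noteq> Q" by auto
  then obtain i where i: "i \<in> I" and FG: "F \<subseteq> {x \<in> Q. f i x = b i}"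
    and GQ: "{x \<in> Q. f i x = b i} \<noteq> Q"
    using proper_face_tight_constraint[OF lin finI aff Q face ne] by metis
  define G where "G = {x \<in> Q. f i x = b i}"
  have "G \<noteq> {}" "G \<subseteq> Q" using FG ne by (auto simp: G_def)
  have dimG: "affdim G < affdim Q"
    using affdim_tight_less[OF lin[OF i] finT span _ GQ] \<open>G \<noteq> {}\<close> by (simp add: G_def)
  have "F = G"
  proof (rule ccontr)
    assume "F \<noteq> G"
    have faceG: "F face_of G"
      using face_of_subset[OF face] FG \<open>G \<subseteq> Q\<close> by (simp add: G_def)
    have affG: "affine {x \<in> V. f i x = b i}"
      using aff lin[OF i]
      by (auto simp: affine_def linear_add linear_scale simp flip: distrib_right)
    \<comment> \<open>\<open>G\<close> obeys the same constraints as \<open>Q\<close>, within an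
      affine slice of \<open>V\<close>. To allow this, the ambient set is affine rather than a
      linear subspace.\<close>
    have G: "G = {x \<in> {x \<in> V. f i x = b i}. \<forall>j\<in>I. f j x \<le> b j}"
      by (auto simp: G_def Q)
    obtain j where j: "j \<in> I" and FH: "F \<subseteq> {x \<in> G. f j x = b j}"
      and HG: "{x \<in> G. f j x = b j} \<noteq> G"
      using proper_face_tight_constraint[OF lin finI affG G faceG ne \<open>F \<noteq> G\<close>] by metis
    have spanG: "G \<subseteq> span T" using \<open>G \<subseteq> Q\<close> span by blast
    have "affdim F \<le> affdim {x \<in> G. f j x = b j}"
      using affdim_mono[OF FH finT] spanG by blast
    also have "\<dots> < affdim G"
      using affdim_tight_less[OF lin[OF j] finT spanG _ HG] FH ne by blast
    finally show False using dimG dimF by simp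
  qed
  then show ?thesis using that i by (simp add: G_def)
qed

lemma card_facets_le:
  fixes f :: "'i \<Rightarrow> 'a::real_vector \<Rightarrow> real"
  assumes "\<And>i. i \<in> I \<Longrightarrow> linear (f i)" "finite I" "affine V"
    and "Q = {x \<in> V. \<forall>i\<in>I. f i x \<le> b i}" "finite T" "Q \<subseteq> span T"
  shows "card (facets Q) \<le> card I"
proof -
  have "facets Q \<subseteq> (\<lambda>i. {x \<in> Q. f i x = b i}) ` I"
    using facet_eq_tight_set[OF assms] by blast
  then show ?thesis
    using assms(2) by (rule surj_card_le[rotated])
qed

section \<open>Relaxation complexity and systems of linear inequalities\<close>

lemma lookup_scaleR [simp]:
  "Poly_Mapping.lookup (c *\<^sub>R x) i = c *\<^sub>R Poly_Mapping.lookup x i"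
proof -
  have "finite {i. c *\<^sub>R Poly_Mapping.lookup x i \<noteq> 0}"
    by (rule finite_subset[OF _ finite_lookup[of x]]) auto
  then show ?thesis by (simp add: scaleR_poly_mapping_def)
qed

lemma mem_Rspace_iff: "x \<in> Rspace d \<longleftrightarrow> (\<forall>i\<ge>d. Poly_Mapping.lookup x i = 0)"
  unfolding Rspace_def subset_eq Ball_def in_keys_iff mem_Collect_eq lessThan_iff
  by (meson not_le)

lemma subspace_Rspace: "subspace (Rspace d)"
  by (auto simp: subspace_def mem_Rspace_iff lookup_add)

lemma Rspace_subset_span: "Rspace d \<subseteq> span ((\<lambda>i. Poly_Mapping.single i 1) ` {..<d})"
proof
  fix x :: rvec assume x: "x \<in> Rspace d"
  have "x = (\<Sum>i<d. Poly_Mapping.lookup x i *\<^sub>R Poly_Mapping.single i 1)"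
  proof (rule poly_mapping_eqI)
    fix k
    have "(\<Sum>i<d. Poly_Mapping.lookup x i * (1 when i = k)) = Poly_Mapping.lookup x k"
      using x by (cases "k < d") (auto simp: when_def mem_Rspace_iff if_distrib cong: if_cong)
    then show "Poly_Mapping.lookup x k =
        Poly_Mapping.lookup (\<Sum>i<d. Poly_Mapping.lookup x i *\<^sub>R Poly_Mapping.single i 1) k"
      by (simp add: lookup_sum lookup_single)
  qed
  also have "\<dots> \<in> span ((\<lambda>i. Poly_Mapping.single i 1) ` {..<d})"
    by (intro span_sum span_scale span_base) auto
  finally show "x \<in> span ((\<lambda>i. Poly_Mapping.single i 1) ` {..<d})" .
qed

lemma ex_Rspace_lookup: "\<exists>a\<in>Rspace d. \<forall>i<d. Poly_Mapping.lookup a i = g i"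
proof -
  have "finite {i. (if i < d then g i else 0) \<noteq> 0}"
    by (rule finite_subset[of _ "{..<d}"]) auto
  then have "Poly_Mapping.lookup (Abs_poly_mapping (\<lambda>i. if i < d then g i else 0)) =
      (\<lambda>i. if i < d then g i else 0)"
    by simp
  then show ?thesis
    by (intro bexI[of _ "Abs_poly_mapping (\<lambda>i. if i < d then g i else 0)"])
       (auto simp: mem_Rspace_iff)
qed

text \<open>Reduces an upper bound on \<open>rc\<close> to finding inequalities with integer
  solution set \<open>X\<close>. A coefficient vector that vanishes below \<open>d\<close> defines
  no half-space; as \<open>b\<close> is nonnegative, such an inequality always holds and is dropped
  from the family.\<close>

lemma rc_le_card_inequalities:
  assumes fin: "finite K" and nonneg: "\<And>g b. (g, b) \<in> K \<Longrightarrow> 0 \<le> b"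
    and X: "{x \<in> Zlattice d. \<forall>(g, b)\<in>K. (\<Sum>i<d. g i * Poly_Mapping.lookup x i) \<le> b} = X"
  shows "rc d X \<le> enat (card K)"
proof -
  define f :: "(nat \<Rightarrow> real) \<times> real \<Rightarrow> rvec \<Rightarrow> real"
    where "f k x = (\<Sum>i<d. fst k i * Poly_Mapping.lookup x i)" for k x
  define Q where "Q = {x \<in> Rspace d. \<forall>k\<in>K. f k x \<le> snd k}"
  have lin: "linear (f k)" for k
    by (rule linearI)
       (simp_all add: f_def lookup_add algebra_simps sum.distrib sum_distrib_left)
  define K' where "K' = {k \<in> K. \<exists>i<d. fst k i \<noteq> 0}"
  define \<H> where "\<H> = (\<lambda>k. {x \<in> Rspace d. f k x \<le> snd k}) ` K'"
  have "halfspace_in d H" if "H \<in> \<H>" for H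
  proof -
    obtain k where k: "k \<in> K'" and H: "H = {x \<in> Rspace d. f k x \<le> snd k}"
      using \<open>H \<in> \<H>\<close> unfolding \<H>_def by blast
    obtain a where a: "a \<in> Rspace d" "\<forall>i<d. Poly_Mapping.lookup a i = fst k i"
      using ex_Rspace_lookup by blast
    have "f k x = dotp d a x" for x
      using a(2) by (simp add: f_def dotp_def)
    moreover have "a \<noteq> 0"
      using k a(2) by (auto simp: K'_def)
    ultimately show ?thesis
      using a(1) H by (auto simp: halfspace_in_def)
  qed
  moreover have "Q = Rspace d \<inter> \<Inter>\<H>"
  proof -
    have "f k x \<le> snd k" if "k \<in> K" "k \<notin> K'" for k x
      using that nonneg[of "fst k" "snd k"] by (simp add: K'_def f_def)
    moreover have "K' \<subseteq> K" by (auto simp: K'_def)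
    ultimately show ?thesis
      unfolding Q_def \<H>_def by blast
  qed
  moreover have "finite \<H>"
    using fin by (simp add: \<H>_def K'_def)
  ultimately have "polyhedron_in d Q"
    by (auto simp: polyhedron_in_def)
  moreover have "Q \<inter> Zlattice d = X"
    by (auto simp: Q_def f_def Zlattice_def simp flip: X)
  ultimately have "rc d X \<le> enat (card (facets Q))"
    unfolding rc_def relaxation_def by (intro Inf_lower) blast
  also have "card (facets Q) \<le> card K"
  proof (rule card_facets_le[OF lin fin _ Q_def])
    show "affine (Rspace d)"
      by (rule subspace_imp_affine[OF subspace_Rspace])
    show "Q \<subseteq> span ((\<lambda>i. Poly_Mapping.single i 1) ` {..<d})"
      using Rspace_subset_span by (auto simp: Q_def)
  qed auto
  finally show ?thesis by simp
qed

section \<open>Positive reals that are linearly independent over the integers\<close>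

definition int_independent :: "(nat \<Rightarrow> real) \<Rightarrow> bool" where
  "int_independent w \<longleftrightarrow>
     (\<forall>S c. finite S \<longrightarrow> (\<Sum>i\<in>S. w i * of_int (c i)) = 0 \<longrightarrow> (\<forall>i\<in>S. c i = 0))"

text \<open>Powers of a transcendental \<open>t\<close> in (0,1) work: an integer relation between
  them is an integer polynomial with root \<open>t\<close>. Such a \<open>t\<close> exists because
  there are only countably many algebraic numbers.\<close>

lemma ex_positive_int_independent: "\<exists>w. (\<forall>i. 0 < w i) \<and> int_independent w"
proof -
  define Z where "Z = {p :: real poly. \<forall>i. coeff p i \<in> \<int>}"
  define A where "A = (\<Union>p\<in>Z - {0}. {t. poly p t = 0})"
  \<comment> \<open>The floors of the coefficients form an integer list that determines the
    polynomial, so \<open>Z\<close> is countable.\<close>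
  have "inj_on (map floor \<circ> coeffs) Z"
  proof (rule inj_on_inverseI[where g = "Poly \<circ> map of_int"])
    fix p assume "p \<in> Z"
    then have "set (coeffs p) \<subseteq> \<int>"
      by (auto simp: Z_def coeffs_def)
    then have "map (of_int \<circ> floor) (coeffs p) = coeffs p"
      by (intro map_idI) (auto elim!: Ints_cases)
    then show "(Poly \<circ> map of_int) ((map floor \<circ> coeffs) p) = p"
      by simp
  qed
  then have "countable Z"
    by (rule countableI')
  then have "countable A"
    unfolding A_def
    by (intro countable_UN countable_Diff) (auto intro: countable_finite poly_roots_finite)
  moreover have "uncountable {0<..<1::real}"
    by (simp add: uncountable_open_interval)
  ultimately obtain t where t: "t \<in> {0<..<1}" "t \<notin> A"
    by (meson countable_subset subsetI)
  have "int_independent (\<lambda>i. t ^ i)"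
    unfolding int_independent_def
  proof (intro allI impI)
    fix S :: "nat set" and c :: "nat \<Rightarrow> int"
    assume S: "finite S" and eq: "(\<Sum>i\<in>S. t ^ i * of_int (c i)) = 0"
    define p where "p = (\<Sum>i\<in>S. monom (real_of_int (c i)) i)"
    have coeff: "coeff p k = (if k \<in> S then c k else 0)" for k
      using S by (simp add: p_def coeff_sum if_distrib cong: if_cong)
    then have "p \<in> Z"
      by (simp add: Z_def)
    moreover have "poly p t = 0"
      using eq by (simp add: p_def poly_sum poly_monom mult.commute)
    ultimately have "p = 0"
      using t(2) by (auto simp: A_def)
    then show "\<forall>i\<in>S. c i = 0"
      using coeff by (metis coeff_0 of_int_eq_0_iff)
  qed
  then show ?thesis
    using t(1) by (intro exI[of _ "\<lambda>i. t ^ i"]) simp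
qed

section \<open>Integer points satisfying the line inequalities\<close>

text \<open>Serves twice: for the fibre sums over the positions \<open>(a, b)\<close>, and for the
  coordinates themselves.\<close>

lemma int_nonneg_sum_le_one:
  fixes x :: "'a \<Rightarrow> int"
  assumes "finite S" "\<And>i. i \<in> S \<Longrightarrow> 0 \<le> x i" "sum x S \<le> 1"
  shows "(\<forall>i\<in>S. x i = 0) \<or> (\<exists>j\<in>S. x j = 1 \<and> (\<forall>i\<in>S - {j}. x i = 0))"
proof (rule disjCI)
  assume "\<not> (\<exists>j\<in>S. x j = 1 \<and> (\<forall>i\<in>S - {j}. x i = 0))"
  show "\<forall>i\<in>S. x i = 0"
  proof (rule ccontr)
    assume "\<not> (\<forall>i\<in>S. x i = 0)"
    then obtain j where j: "j \<in> S" "x j \<noteq> 0" by blast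
    have "sum x S = x j + sum x (S - {j})"
      using assms(1) j(1) by (rule sum.remove)
    moreover have "0 \<le> sum x (S - {j})"
      by (intro sum_nonneg) (use assms(2) in auto)
    moreover have "1 \<le> x j"
      using assms(2)[OF j(1)] j(2) by simp
    ultimately have "x j = 1" "sum x (S - {j}) = 0"
      using assms(3) by auto
    moreover from this have "\<forall>i\<in>S - {j}. x i = 0"
      using sum_nonneg_eq_0_iff[of "S - {j}" x] assms(1,2) by auto
    ultimately show False
      using \<open>\<not> (\<exists>j\<in>S. x j = 1 \<and> (\<forall>i\<in>S - {j}. x i = 0))\<close> j(1) by blast
  qed
qed

text \<open>The coordinate functions are abstract so that both kinds of plane are covered, by
  exchanging \<open>r\<close> and \<open>s\<close>. \<open>S\<close> may fill only part of the cube,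
  since missing entries merely shorten the sums.\<close>

lemma plane_zero:
  fixes x :: "'a \<Rightarrow> int" and r s t :: "'a \<Rightarrow> nat"
  assumes fin: "finite S" and indep: "int_independent w"
    and s: "s ` S \<subseteq> {..<n}" and t: "t ` S \<subseteq> {..<n}"
    and inj: "inj_on (\<lambda>i. (r i, s i, t i)) S"
    and lines: "\<And>c. c < n \<Longrightarrow> 0 \<le> (\<Sum>i | i \<in> S \<and> r i = a \<and> t i = c. w (s i) * x i)"
    and zero: "\<And>b. b < n \<Longrightarrow> (\<Sum>i | i \<in> S \<and> r i = a \<and> s i = b. x i) = 0"
    and i: "i \<in> S" "r i = a"
  shows "x i = 0"
proof -
  define P where "P = {i \<in> S. r i = a}"
  have finP: "finite P" using fin by (simp add: P_def)
  have P: "{i. i \<in> P \<and> h i = c} = {i. i \<in> S \<and> r i = a \<and> h i = c}" for h :: "'a \<Rightarrow> nat" and c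
    by (auto simp: P_def)
  \<comment> \<open>The weighted sum over the plane is computed twice: along the lines on which
    \<open>t\<close> is constant, and along those on which \<open>s\<close> is constant, where the
    weight factors out.\<close>
  have "(\<Sum>c<n. \<Sum>i | i \<in> P \<and> t i = c. w (s i) * x i) = (\<Sum>i\<in>P. w (s i) * x i)"
    by (rule sum.group) (use finP t in \<open>auto simp: P_def\<close>)
  also have "\<dots> = (\<Sum>b<n. \<Sum>i | i \<in> P \<and> s i = b. w (s i) * x i)"
    by (rule sum.group[symmetric]) (use finP s in \<open>auto simp: P_def\<close>)
  also have "\<dots> = (\<Sum>b<n. w b * of_int (\<Sum>i | i \<in> P \<and> s i = b. x i))"
    by (simp add: sum_distrib_left)
  also have "\<dots> = 0"
    by (simp add: P zero)
  finally have "(\<Sum>c<n. \<Sum>i | i \<in> P \<and> t i = c. w (s i) * x i) = 0" .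
  then have "\<forall>c\<in>{..<n}. (\<Sum>i | i \<in> P \<and> t i = c. w (s i) * x i) = 0"
    by (subst (asm) sum_nonneg_eq_0_iff) (auto simp: P lines)
  then have line: "(\<Sum>j | j \<in> P \<and> t j = t i. w (s j) * x j) = 0"
    using t i by auto
  define L where "L = {j. j \<in> P \<and> t j = t i}"
  have inj_s: "inj_on s L"
    using inj by (auto simp: inj_on_def L_def P_def)
  \<comment> \<open>Independence speaks of weights indexed by \<open>b\<close>. As \<open>s\<close>
    is injective on the line, each \<open>b\<close> occurring there carries just one entry of
    \<open>x\<close>, its integer coefficient.\<close>
  have "(\<Sum>b\<in>s ` L. w b * of_int (x (inv_into L s b))) = (\<Sum>j\<in>L. w (s j) * x j)"
    by (simp add: sum.reindex[OF inj_s] inv_into_f_f[OF inj_s])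
  then have "\<forall>b\<in>s ` L. x (inv_into L s b) = 0"
    using indep[unfolded int_independent_def, rule_format, of "s ` L" "\<lambda>b. x (inv_into L s b)"]
      line finP by (simp add: L_def)
  then show ?thesis
    using i inv_into_f_f[OF inj_s] by (auto simp: L_def P_def)
qed

lemma integer_points_line_inequalities:
  fixes x :: "'a \<Rightarrow> int" and r s t :: "'a \<Rightarrow> nat"
  assumes fin: "finite S" and indep: "int_independent w" and pos: "\<And>i. 0 < w i"
    and r: "r ` S \<subseteq> {..<n}" and s: "s ` S \<subseteq> {..<n}" and t: "t ` S \<subseteq> {..<n}"
    and inj: "inj_on (\<lambda>i. (r i, s i, t i)) S"
    and rt: "\<And>a c. a < n \<Longrightarrow> c < n \<Longrightarrow> 0 \<le> (\<Sum>i | i \<in> S \<and> r i = a \<and> t i = c. w (s i) * x i)"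
    and st: "\<And>b c. b < n \<Longrightarrow> c < n \<Longrightarrow> 0 \<le> (\<Sum>i | i \<in> S \<and> s i = b \<and> t i = c. w (r i) * x i)"
    and rs: "\<And>a b. a < n \<Longrightarrow> b < n \<Longrightarrow> 0 \<le> (\<Sum>i | i \<in> S \<and> r i = a \<and> s i = b. x i)"
    and le: "sum x S \<le> 1"
  shows "(\<forall>i\<in>S. x i = 0) \<or> (\<exists>j\<in>S. x j = 1 \<and> (\<forall>i\<in>S - {j}. x i = 0))"
proof (rule int_nonneg_sum_le_one[OF fin _ le])
  \<comment> \<open>Only nonnegativity of the entries is left to prove.\<close>
  define y where "y = (\<lambda>(a, b). \<Sum>i | i \<in> S \<and> r i = a \<and> s i = b. x i)"
  have "sum y ({..<n} \<times> {..<n}) = (\<Sum>p\<in>{..<n} \<times> {..<n}. \<Sum>i | i \<in> S \<and> (r i, s i) = p. x i)"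
    by (intro sum.cong) (auto simp: y_def)
  also have "\<dots> = sum x S"
    by (rule sum.group) (use fin r s in auto)
  finally have "sum y ({..<n} \<times> {..<n}) \<le> 1" using le by simp
  then have "(\<forall>p\<in>{..<n} \<times> {..<n}. y p = 0) \<or>
      (\<exists>q\<in>{..<n} \<times> {..<n}. y q = 1 \<and> (\<forall>p\<in>{..<n} \<times> {..<n} - {q}. y p = 0))"
    by (intro int_nonneg_sum_le_one) (auto simp: y_def rs)
  \<comment> \<open>If all \<open>y p\<close> vanish, any pair can serve as
    \<open>(a0, b0)\<close>.\<close>
  then obtain a0 b0 where "\<forall>p\<in>{..<n} \<times> {..<n} - {(a0, b0)}. y p = 0"
    by (metis DiffD1 surj_pair)
  then have y0: "(\<Sum>i | i \<in> S \<and> r i = a \<and> s i = b. x i) = 0"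
    if "a < n" "b < n" "a \<noteq> a0 \<or> b \<noteq> b0" for a b
    using that by (force simp: y_def)
  have inj': "inj_on (\<lambda>i. (s i, r i, t i)) S"
    using inj by (auto simp: inj_on_def)
  have y0': "(\<Sum>i | i \<in> S \<and> s i = b \<and> r i = a. x i) = 0"
    if "a < n" "b < n" "a \<noteq> a0 \<or> b \<noteq> b0" for a b
    using y0[OF that] by (simp add: conj_commute)
  have off: "x i = 0" if i: "i \<in> S" and ne: "r i \<noteq> a0 \<or> s i \<noteq> b0" for i
  proof (cases "r i = a0")
    case False
    then show ?thesis
      using plane_zero[OF fin indep s t inj rt y0 i refl] i r by auto
  next
    case True
    then show ?thesis
      using plane_zero[OF fin indep r t inj' st y0' i refl] i s ne by auto
  qed
  fix i assume i: "i \<in> S"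
  show "0 \<le> x i"
  proof (cases "r i = a0 \<and> s i = b0")
    case True
    \<comment> \<open>\<open>?L\<close> is the line through \<open>i\<close> on which only
      \<open>s\<close> varies. Its other entries have \<open>s j \<noteq> b0\<close> and vanish, so
      its inequality reduces to \<open>w (s i) * x i\<close> being nonnegative; positivity of
      \<open>w\<close> finishes.\<close>
    let ?L = "{j. j \<in> S \<and> r j = r i \<and> t j = t i}"
    have "(\<Sum>j\<in>?L. w (s j) * x j) = (\<Sum>j\<in>{i}. w (s j) * x j)"
    proof (rule sum.mono_neutral_right)
      show "\<forall>j\<in>?L - {i}. w (s j) * x j = 0"
      proof
        fix j assume j: "j \<in> ?L - {i}"
        then have "s j \<noteq> s i" using inj i by (auto simp: inj_on_def)
        then show "w (s j) * x j = 0" using off j True by auto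
      qed
    qed (use fin i in auto)
    moreover have "0 \<le> (\<Sum>j\<in>?L. w (s j) * x j)"
      by (rule rt) (use i r t in auto)
    ultimately show ?thesis
      using pos[of "s i"] by (simp add: zero_le_mult_iff)
  next
    case False
    then show ?thesis using off i by auto
  qed
qed

section \<open>The relaxation\<close>

text \<open>Two divisions with remainder recover \<open>i\<close>. The last component is a full
  quotient, not reduced modulo \<open>n\<close>; it is a digit below \<open>n\<close> only for
  \<open>i < n ^ 3\<close>.\<close>

lemma inj_base_digits: "inj (\<lambda>i::nat. (i mod n, i div n mod n, i div n div n))"
  by (rule injI) (metis Pair_inject div_mult_mod_eq)

lemma Delta_subset_Zlattice: "Delta d \<subseteq> Zlattice d"
  by (auto simp: Delta_def Zlattice_def mem_Rspace_iff lookup_single when_def)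

lemma rc_Delta_le:
  assumes d: "d \<le> n ^ 3"
  shows "rc d (Delta d) \<le> enat (3 * n\<^sup>2 + 1)"
proof -
  obtain w :: "nat \<Rightarrow> real" where pos: "\<And>i. 0 < w i" and indep: "int_independent w"
    using ex_positive_int_independent by blast
  define r s t :: "nat \<Rightarrow> nat"
    where "r = (\<lambda>i. i mod n)" and "s = (\<lambda>i. i div n mod n)" and "t = (\<lambda>i. i div n div n)"
  have t: "t i < n" if "i < d" for i
  proof -
    have "i < n * n * n" using that d by (simp add: power3_eq_cube)
    then show ?thesis
      by (simp add: t_def less_mult_imp_div_less)
  qed
  have n: "0 < n" if "i < d" for i
    using that d by (cases n) auto
  have rst: "r ` {..<d} \<subseteq> {..<n}" "s ` {..<d} \<subseteq> {..<n}" "t ` {..<d} \<subseteq> {..<n}"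
    using t n by (auto simp: r_def s_def)
  have inj: "inj_on (\<lambda>i. (r i, s i, t i)) {..<d}"
    using inj_base_digits[of n] by (auto simp: r_def s_def t_def intro: inj_on_subset)
  define N where "N = {..<n} \<times> {..<n}"
  \<comment> \<open>The line inequalities are negated to have the form \<open>\<le> 0\<close>.
    Indices from \<open>d\<close> on also receive coefficients, but the sums stop below
    \<open>d\<close>.\<close>
  define K1 K2 K3 where
    "K1 = (\<lambda>(a, c). (\<lambda>i. if r i = a \<and> t i = c then - w (s i) else 0, 0::real)) ` N"
    and "K2 = (\<lambda>(b, c). (\<lambda>i. if s i = b \<and> t i = c then - w (r i) else 0, 0::real)) ` N"
    and "K3 = (\<lambda>(a, b). (\<lambda>i. if r i = a \<and> s i = b then - 1 else 0 :: real, 0::real)) ` N"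
  define K where "K = insert (\<lambda>_. 1, 1) (K1 \<union> K2 \<union> K3)"
  have finN: "finite N" and cardN: "card N = n\<^sup>2"
    by (auto simp: N_def power2_eq_square)
  have finK: "finite K"
    using finN by (simp add: K_def K1_def K2_def K3_def)
  have "card K \<le> 3 * n\<^sup>2 + 1"
  proof -
    have "card K1 \<le> n\<^sup>2" "card K2 \<le> n\<^sup>2" "card K3 \<le> n\<^sup>2"
      unfolding K1_def K2_def K3_def cardN[symmetric] by (intro card_image_le finN)+
    moreover have "card K \<le> Suc (card (K1 \<union> K2 \<union> K3))"
      unfolding K_def by (rule card_insert_le_m1) auto
    moreover have "card (K1 \<union> K2 \<union> K3) \<le> card K1 + card K2 + card K3"
      by (meson add_le_mono1 card_Un_le le_trans)
    ultimately show ?thesis by linarith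
  qed
  moreover have "rc d (Delta d) \<le> enat (card K)"
  proof (rule rc_le_card_inequalities[OF finK])
    show "0 \<le> b" if "(g, b) \<in> K" for g b
      using that by (auto simp: K_def K1_def K2_def K3_def)
    have filter: "(\<Sum>i<d. (if P i then - u i else 0) * v i) = - (\<Sum>i | i \<in> {..<d} \<and> P i. u i * v i)"
      for P and u v :: "nat \<Rightarrow> real"
    proof -
      have "(\<Sum>i<d. (if P i then - u i else 0) * v i) = (\<Sum>i<d. if P i then - (u i * v i) else 0)"
        by (intro sum.cong) auto
      also have "\<dots> = (\<Sum>i | i \<in> {..<d} \<and> P i. - (u i * v i))"
        using sum.inter_filter[of "{..<d}" "\<lambda>i. - (u i * v i)" P] by simp
      finally show ?thesis by (simp add: sum_negf)
    qed
    show "{x \<in> Zlattice d. \<forall>(g, b)\<in>K. (\<Sum>i<d. g i * Poly_Mapping.lookup x i) \<le> b} = Delta d"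
      (is "?X = _")
    proof
      show "?X \<subseteq> Delta d"
      proof
        fix x assume "x \<in> ?X"
        then have xZ: "x \<in> Zlattice d"
          and ineq: "\<And>g b. (g, b) \<in> K \<Longrightarrow> (\<Sum>i<d. g i * Poly_Mapping.lookup x i) \<le> b"
          by auto
        define z where "z i = \<lfloor>Poly_Mapping.lookup x i\<rfloor>" for i
        have z: "Poly_Mapping.lookup x i = of_int (z i)" for i
          using xZ by (auto simp: Zlattice_def z_def)
        have out: "Poly_Mapping.lookup x i = 0" if "d \<le> i" for i
          using xZ that by (simp add: Zlattice_def mem_Rspace_iff)
        have "(\<forall>i\<in>{..<d}. z i = 0) \<or> (\<exists>j\<in>{..<d}. z j = 1 \<and> (\<forall>i\<in>{..<d} - {j}. z i = 0))"
        proof (rule integer_points_line_inequalities[OF _ indep pos rst inj])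
          fix a c assume "a < n" "c < n"
          then have N: "(a, c) \<in> N" by (simp add: N_def)
          have "(\<lambda>i. if r i = a \<and> t i = c then - w (s i) else 0, 0) \<in> K"
            using N by (force simp: K_def K1_def)
          from ineq[OF this]
          show "0 \<le> (\<Sum>i | i \<in> {..<d} \<and> r i = a \<and> t i = c. w (s i) * z i)"
            unfolding z filter by simp
          have "(\<lambda>i. if s i = a \<and> t i = c then - w (r i) else 0, 0) \<in> K"
            using N by (force simp: K_def K2_def)
          from ineq[OF this]
          show "0 \<le> (\<Sum>i | i \<in> {..<d} \<and> s i = a \<and> t i = c. w (r i) * z i)"
            unfolding z filter by simp
          have "(\<lambda>i. if r i = a \<and> s i = c then - 1 else 0, 0) \<in> K"
            using N by (force simp: K_def K3_def)
          from ineq[OF this]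
          have "0 \<le> real_of_int (\<Sum>i | i \<in> {..<d} \<and> r i = a \<and> s i = c. z i)"
            unfolding z filter by simp
          then show "0 \<le> (\<Sum>i | i \<in> {..<d} \<and> r i = a \<and> s i = c. z i)"
            by (simp only: of_int_0_le_iff)
        next
          have "(\<lambda>_. 1, 1) \<in> K" by (simp add: K_def)
          from ineq[OF this] have "real_of_int (\<Sum>i<d. z i) \<le> 1"
            unfolding z by simp
          then show "(\<Sum>i<d. z i) \<le> 1"
            by (simp only: of_int_le_1_iff)
        qed simp
        then consider "\<forall>i<d. z i = 0" | j where "j < d" "z j = 1" "\<forall>i<d. i \<noteq> j \<longrightarrow> z i = 0"
          unfolding Ball_def Bex_def Diff_iff lessThan_iff singleton_iff by blast
        then show "x \<in> Delta d"
        proof cases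
          case 1
          have "x = 0"
          proof (rule poly_mapping_eqI)
            fix i
            show "Poly_Mapping.lookup x i = Poly_Mapping.lookup 0 i"
              using 1 z[of i] out[of i] by (cases "i < d") auto
          qed
          then show ?thesis by (simp add: Delta_def)
        next
          case (2 j)
          have "x = Poly_Mapping.single j 1"
          proof (rule poly_mapping_eqI)
            fix i
            show "Poly_Mapping.lookup x i = Poly_Mapping.lookup (Poly_Mapping.single j 1) i"
              using 2 z[of i] out[of i]
              by (cases "i < d"; cases "i = j") (auto simp: lookup_single)
          qed
          then show ?thesis using 2 by (simp add: Delta_def)
        qed
      qed
    next
      have "(\<Sum>i<d. g i * Poly_Mapping.lookup (Poly_Mapping.single j 1) i) = g j"
        if "j < d" for g :: "nat \<Rightarrow> real" and j
        using that by (simp add: lookup_single when_def if_distrib cong: if_cong)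
      \<comment> \<open>At a unit vector the left-hand side is the single coefficient
        \<open>g j\<close>, which is nonpositive against the bound 0 or equal to 1 against the bound
        1; at the origin it is 0.\<close>
      moreover have "g j \<le> b" "0 \<le> b" if "(g, b) \<in> K" for g b j
        using that less_imp_le[OF pos] by (auto simp: K_def K1_def K2_def K3_def)
      ultimately show "Delta d \<subseteq> ?X"
        using Delta_subset_Zlattice[of d] by (auto simp: Delta_def)
    qed
  qed
  ultimately show ?thesis
    by (meson enat_ord_simps(1) order_trans)
qed

section \<open>Choice of the cube and the asymptotic estimate\<close>

lemma ex_cube_between:
  assumes "2 \<le> (d::nat)"
  shows "\<exists>n\<ge>2. d \<le> n ^ 3 \<and> n ^ 3 \<le> 8 * d"
proof -
  define n where "n = (LEAST n. d \<le> n ^ 3)"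
  have "d \<le> d ^ 3" by (rule self_le_power) (use assms in auto)
  then have dn: "d \<le> n ^ 3" unfolding n_def by (rule LeastI)
  then have n2: "2 \<le> n"
    using assms by (cases "n = 0 \<or> n = 1") auto
  have "\<not> d \<le> (n - 1) ^ 3"
    unfolding n_def by (rule not_less_Least) (use n2 in \<open>auto simp: n_def\<close>)
  \<comment> \<open>The factor 8 arises here: \<open>n \<le> 2 * (n - 1)\<close> because
    \<open>n\<close> is at least 2, and minimality of \<open>n\<close> gives
    \<open>(n - 1) ^ 3 < d\<close>.\<close>
  moreover have "n ^ 3 \<le> (2 * (n - 1)) ^ 3"
    by (rule power_mono) (use n2 in auto)
  ultimately have "n ^ 3 \<le> 8 * d"
    by (simp add: power_mult_distrib)
  with dn n2 show ?thesis by blast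
qed

theorem theorem3:
  shows "\<exists>C>0. \<forall>d\<ge>2.
    ereal_of_enat (rc d (Delta d)) \<le> ereal (C * (real d / sqrt (ln (real d))))"
proof (intro exI[of _ 64] conjI allI impI)
  \<comment> \<open>The constant: at most \<open>4 * n^2\<close> inequalities, times
    \<open>sqrt (ln d) \<le> 2 * n\<close>, make \<open>8 * n^3\<close>, which is at most
    \<open>64 * d\<close>.\<close>
  fix d :: nat assume d: "2 \<le> d"
  obtain n where n: "2 \<le> n" "d \<le> n ^ 3" "n ^ 3 \<le> 8 * d"
    using ex_cube_between[OF d] by blast
  have ln_pos: "0 < ln (real d)" using d by simp
  have "ln (real d) \<le> ln (real n ^ 3)"
  proof (subst ln_le_cancel_iff)
    show "real d \<le> real n ^ 3"
      using n(2) by (metis of_nat_le_iff of_nat_power)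
  qed (use n(1) d in auto)
  also have "\<dots> = 3 * ln (real n)"
    using n(1) by (simp add: ln_realpow)
  \<comment> \<open>This crude bound suffices: with order \<open>n^2\<close> inequalities and
    \<open>d\<close> of order \<open>n^3\<close>, the root of the logarithm may be as large as order
    \<open>n\<close>.\<close>
  also have "\<dots> \<le> 3 * real n"
    using ln_bound[of "real n"] n(1) by simp
  also have "\<dots> \<le> (2 * real n)\<^sup>2"
    using n(1) by (simp add: power2_eq_square)
  finally have "sqrt (ln (real d)) \<le> 2 * real n"
    by (intro real_le_lsqrt) auto
  then have "4 * (real n)\<^sup>2 * sqrt (ln (real d)) \<le> 4 * (real n)\<^sup>2 * (2 * real n)"
    by (intro mult_left_mono) auto
  also have "\<dots> = 8 * real (n ^ 3)"
    by (simp add: power2_eq_square power3_eq_cube)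
  also have "\<dots> \<le> 64 * real d"
    using n(3) by linarith
  finally have "4 * (real n)\<^sup>2 \<le> 64 * (real d / sqrt (ln (real d)))"
    using ln_pos by (simp add: field_simps)
  moreover have "real (3 * n\<^sup>2 + 1) \<le> 4 * (real n)\<^sup>2"
    using n(1) by simp
  ultimately have "real (3 * n\<^sup>2 + 1) \<le> 64 * (real d / sqrt (ln (real d)))"
    by linarith
  moreover have "ereal_of_enat (rc d (Delta d)) \<le> ereal_of_enat (enat (3 * n\<^sup>2 + 1))"
    using rc_Delta_le[OF n(2)] by (simp only: ereal_of_enat_le_iff)
  ultimately show "ereal_of_enat (rc d (Delta d)) \<le> ereal (64 * (real d / sqrt (ln (real d))))"
    by (metis ereal_less_eq(3) ereal_of_enat_simps(1) order_trans)
qed simp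

end
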